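(* Let $k\ge 2$ be a fixed integer, and let $\mathcal{L}_k$ be the set of irreducible prohibited patterns for $k$. Then $\mathcal{L}_k$ is finite. Moreover, the longest patterns in $\mathcal{L}_k$ are of length $2k-1$.
   Context: A permutation of $\{1,\ldots,n\}$ is written as a word; its length is $n$. The pattern of a word of $m$ distinct integers is the unique permutation of $\{1,\ldots,m\}$ order-isomorphic to it. A prohibited pattern (for $k$) is a permutation of the form $xX(x+1)$ or $(x+1)Xx$, where $x\geq 1$, $X$ is a word of length $|X|\ge k-1$, and $X$ is a permutation of $\{1,2,\ldots,|X|+2\}\setminus\{x,x+1\}$. Write a prohibited pattern as $aYb$, where $a$ and $b$ are its first and last elements (which are consecutive integers) and $Y$ is a word. It is called irreducible if the patterns of $Yb$ and of $aY$ are both uniquely $k$-determined permutations (i.e. these proper factors contain no prohibition). The set $\mathcal{L}_k$ consists of all irreducible prohibited patterns, of all lengths. Uniquely $k$-determined: let $\mathcal{P}_k$ be the graph whose nodes are all $k$-permutations, with an arc from $a_1\ldots a_k$ to $b_1\ldots b_k$ if and only if $a_2\ldots a_k$ and $b_1\ldots b_{k-1}$ have the same pattern. For $n\ge k$, to a permutation $\pi=\pi_1\ldots\pi_n$ of $\{1,\ldots,n\}$ corresponds the path in $\mathcal{P}_k$ whose $i$-th node is the pattern of $\pi_i\ldots\pi_{i+k-1}$, $i=1,\ldots,n-k+1$; $\pi$ is uniquely $k$-determined if no other permutation of $\{1,\ldots,n\}$ has the same path. For $n<k$ every permutation of $\{1,\ldots,n\}$ is regarded as uniquely $k$-determined. 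*)

theory Defs
  imports "HOL-Combinatorics.Multiset_Permutations" "Graph_Theory.Graph_Theory"
begin

text \<open>
  Words are lists of natural numbers; a permutation of \<open>{1, \<dots>, n}\<close> is an element of
  \<open>permutations_of_set {1..n}\<close>, that is, a distinct list with element set \<open>{1..n}\<close>.
  List positions are counted from 0.
\<close>

definition order_isomorphic :: "nat list \<Rightarrow> nat list \<Rightarrow> bool" where
  "order_isomorphic u v \<longleftrightarrow>
     length u = length v \<and> (\<forall>i<length u. \<forall>j<length u. u ! i < u ! j \<longleftrightarrow> v ! i < v ! j)"

definition pattern :: "nat list \<Rightarrow> nat list" where
  "pattern w = (THE p. p \<in> permutations_of_set {1..length w} \<and> order_isomorphic p w)"

definition overlap_graph :: "nat \<Rightarrow> nat list pair_pre_digraph" where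
  "overlap_graph k =
     \<lparr>pverts = permutations_of_set {1..k},
      parcs = {(a, b). a \<in> permutations_of_set {1..k} \<and> b \<in> permutations_of_set {1..k} \<and>
                       pattern (tl a) = pattern (butlast b)}\<rparr>"

text \<open>
  A path in the overlap graph is given by its list of nodes (there is at most one arc from a node
  to another); \<open>vwalk_pattern_path\<close> below shows that this list is indeed a walk. Only meaningful
  for \<open>k \<le> length \<pi>\<close>.
\<close>

definition pattern_path :: "nat \<Rightarrow> nat list \<Rightarrow> nat list list" where
  "pattern_path k \<pi> = map (\<lambda>i. pattern (take k (drop i \<pi>))) [0..<length \<pi> - k + 1]"

definition uniquely_determined :: "nat \<Rightarrow> nat list \<Rightarrow> bool" where
  "uniquely_determined k \<pi> \<longleftrightarrow>
     \<pi> \<in> permutations_of_set {1..length \<pi>} \<and>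
     (k \<le> length \<pi> \<longrightarrow>
       (\<forall>\<sigma>\<in>permutations_of_set {1..length \<pi>}. pattern_path k \<sigma> = pattern_path k \<pi> \<longrightarrow> \<sigma> = \<pi>))"

text \<open>
  There is no explicit upper bound on \<open>x\<close>: since \<open>X\<close> is distinct with exactly \<open>length X\<close> elements,
  the condition on \<open>X\<close> forces \<open>x + 1 \<le> length X + 2\<close>.
\<close>

definition prohibited :: "nat \<Rightarrow> nat list \<Rightarrow> bool" where
  "prohibited k w \<longleftrightarrow>
     (\<exists>x X. x \<ge> 1 \<and> length X \<ge> k - 1 \<and>
        X \<in> permutations_of_set ({1..length X + 2} - {x, x + 1}) \<and>
        (w = [x] @ X @ [x + 1] \<or> w = [x + 1] @ X @ [x]))"

definition irreducible_prohibited :: "nat \<Rightarrow> nat list \<Rightarrow> bool" where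
  "irreducible_prohibited k w \<longleftrightarrow>
     prohibited k w \<and>
     uniquely_determined k (pattern (tl w)) \<and> uniquely_determined k (pattern (butlast w))"

definition irreducible_prohibited_patterns :: "nat \<Rightarrow> nat list set" where
  "irreducible_prohibited_patterns k = {w. irreducible_prohibited k w}"


subsection \<open>Well-definedness of patterns and paths\<close>

lemma permutations_of_set_nth_rank:
  assumes p: "p \<in> permutations_of_set {1..m}" and i: "i < m"
  shows "length p = m" "p ! i = card {j. j < m \<and> p ! j \<le> p ! i}"
proof -
  have d: "distinct p" and s: "set p = {1..m}"
    using p by (auto simp: permutations_of_set_def)
  show l: "length p = m" using distinct_card[OF d] s by simp
  have pi: "p ! i \<in> {1..m}" using i l s nth_mem by metis
  have "inj_on ((!) p) {j. j < m \<and> p ! j \<le> p ! i}"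
    using d l by (auto simp: inj_on_def nth_eq_iff_index_eq)
  then have "card {j. j < m \<and> p ! j \<le> p ! i} = card ((!) p ` {j. j < m \<and> p ! j \<le> p ! i})"
    by (simp add: card_image)
  also have "(!) p ` {j. j < m \<and> p ! j \<le> p ! i} = {1..p ! i}"
  proof (intro equalityI subsetI)
    fix y assume "y \<in> (!) p ` {j. j < m \<and> p ! j \<le> p ! i}"
    then obtain j where "j < m" "y = p ! j" "p ! j \<le> p ! i" by auto
    then show "y \<in> {1..p ! i}" using s l nth_mem[of j p] by auto
  next
    fix y assume y: "y \<in> {1..p ! i}"
    then have "y \<in> set p" using s pi by auto
    then obtain j where "j < length p" "p ! j = y" by (auto simp: in_set_conv_nth)
    then show "y \<in> (!) p ` {j. j < m \<and> p ! j \<le> p ! i}" using y l by force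
  qed
  finally show "p ! i = card {j. j < m \<and> p ! j \<le> p ! i}" by simp
qed

lemma order_isomorphic_sym: "order_isomorphic u v \<Longrightarrow> order_isomorphic v u"
  by (auto simp: order_isomorphic_def)

lemma order_isomorphic_trans:
  "order_isomorphic u v \<Longrightarrow> order_isomorphic v w \<Longrightarrow> order_isomorphic u w"
  by (auto simp: order_isomorphic_def)

lemma order_isomorphic_permutations_eq:
  assumes p: "p \<in> permutations_of_set {1..m}" and q: "q \<in> permutations_of_set {1..m}"
    and iso: "order_isomorphic p q"
  shows "p = q"
proof (rule nth_equalityI)
  show "length p = length q" using iso by (simp add: order_isomorphic_def)
  fix i assume "i < length p"
  moreover have l: "length p = m"
    using p distinct_card[of p] by (auto simp: permutations_of_set_def)
  ultimately have i: "i < m" by simp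
  have "p ! j \<le> p ! i \<longleftrightarrow> q ! j \<le> q ! i" if "j < m" for j
    using iso i that l unfolding order_isomorphic_def by (metis linorder_not_less)
  then have "{j. j < m \<and> p ! j \<le> p ! i} = {j. j < m \<and> q ! j \<le> q ! i}" by auto
  then show "p ! i = q ! i"
    using permutations_of_set_nth_rank(2)[OF p i] permutations_of_set_nth_rank(2)[OF q i] by simp
qed

lemma rank_word_is_pattern:
  assumes "distinct w"
  defines "p \<equiv> map (\<lambda>x. card {y \<in> set w. y \<le> x}) w"
  shows "p \<in> permutations_of_set {1..length w}" "order_isomorphic p w"
proof -
  let ?r = "\<lambda>x. card {y \<in> set w. y \<le> x}"
  have mono: "?r x < ?r x'" if "x < x'" "x' \<in> set w" for x x'
  proof (rule psubset_card_mono)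
    have "x' \<in> {y \<in> set w. y \<le> x'}" "x' \<notin> {y \<in> set w. y \<le> x}" using that by auto
    then show "{y \<in> set w. y \<le> x} \<subset> {y \<in> set w. y \<le> x'}" using that by fastforce
  qed simp
  have iff: "?r x < ?r x' \<longleftrightarrow> x < x'" if "x \<in> set w" "x' \<in> set w" for x x'
    using mono[OF _ that(2)] mono[OF _ that(1)] by (metis linorder_less_linear order_less_asym)
  have "inj_on ?r (set w)"
  proof (rule inj_onI)
    fix x x' assume "x \<in> set w" "x' \<in> set w" "?r x = ?r x'"
    then show "x = x'" using iff[of x x'] iff[of x' x] by linarith
  qed
  then have d: "distinct p" using assms(1) by (simp add: p_def distinct_map)
  have "set p \<subseteq> {1..length w}"
  proof
    fix y assume "y \<in> set p"
    then obtain x where x: "x \<in> set w" "y = ?r x" by (auto simp: p_def)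
    have "card {x} \<le> ?r x" by (rule card_mono) (use x in auto)
    moreover have "?r x \<le> card (set w)" by (rule card_mono) auto
    ultimately show "y \<in> {1..length w}" using x card_length[of w] by auto
  qed
  moreover have "card (set p) = length w" using distinct_card[OF d] by (simp add: p_def)
  ultimately have "set p = {1..length w}" by (intro card_subset_eq) auto
  then show "p \<in> permutations_of_set {1..length w}" using d by (simp add: permutations_of_set_def)
  show "order_isomorphic p w"
    unfolding order_isomorphic_def
  proof (intro conjI allI impI)
    show "length p = length w" by (simp add: p_def)
    fix i j assume "i < length p" "j < length p"
    then have ij: "i < length w" "j < length w" by (auto simp: p_def)
    then show "p ! i < p ! j \<longleftrightarrow> w ! i < w ! j"
      using iff[of "w ! i" "w ! j"] by (simp only: p_def nth_map nth_mem)
  qed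
qed

lemma pattern_ex1:
  assumes "distinct w"
  shows "\<exists>!p. p \<in> permutations_of_set {1..length w} \<and> order_isomorphic p w"
  using rank_word_is_pattern[OF assms]
  by (blast intro: order_isomorphic_permutations_eq order_isomorphic_trans order_isomorphic_sym)

lemma
  assumes "distinct w"
  shows pattern_in_permutations: "pattern w \<in> permutations_of_set {1..length w}"
    and pattern_order_isomorphic: "order_isomorphic (pattern w) w"
  using theI'[OF pattern_ex1[OF assms]] by (auto simp: pattern_def)

lemma pattern_eq_rank_word:
  assumes "distinct w"
  shows "pattern w = map (\<lambda>x. card {y \<in> set w. y \<le> x}) w"
  unfolding pattern_def
  by (rule the1_equality[OF pattern_ex1[OF assms]]) (use rank_word_is_pattern[OF assms] in blast)

lemma pattern_cong:
  assumes "order_isomorphic u v"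
  shows "pattern u = pattern v"
proof -
  have "order_isomorphic p u \<longleftrightarrow> order_isomorphic p v" for p
    using assms by (blast intro: order_isomorphic_trans order_isomorphic_sym)
  then show ?thesis using assms by (simp add: pattern_def order_isomorphic_def)
qed

lemma order_isomorphic_tl: "order_isomorphic u v \<Longrightarrow> order_isomorphic (tl u) (tl v)"
  by (auto simp: order_isomorphic_def nth_tl)

lemma order_isomorphic_butlast: "order_isomorphic u v \<Longrightarrow> order_isomorphic (butlast u) (butlast v)"
  by (auto simp: order_isomorphic_def nth_butlast)

lemma vwalk_arcs_nth:
  "e \<in> set (vwalk_arcs p) \<Longrightarrow> \<exists>i. Suc i < length p \<and> e = (p ! i, p ! Suc i)"
proof (induction p rule: vwalk_arcs.induct)
  case (3 x y xs)
  show ?case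
  proof (cases "e = (x, y)")
    case True
    then show ?thesis by (intro exI[of _ 0]) auto
  next
    case False
    then obtain i where "Suc i < length (y # xs)" "e = ((y # xs) ! i, (y # xs) ! Suc i)"
      using 3 by auto
    then show ?thesis by (intro exI[of _ "Suc i"]) auto
  qed
qed auto

lemma vwalk_pattern_path:
  assumes "distinct \<pi>" "k \<le> length \<pi>"
  shows "vwalk (pattern_path k \<pi>) (with_proj (overlap_graph k))"
proof
  let ?f = "\<lambda>i. take k (drop i \<pi>)"
  have df: "distinct (?f i)" for i using assms by simp
  have node: "pattern (?f i) \<in> permutations_of_set {1..k}" if "i \<le> length \<pi> - k" for i
  proof -
    have "length (?f i) = k" using that assms by simp
    then show ?thesis using pattern_in_permutations[OF df, of i] by simp
  qed
  show "set (pattern_path k \<pi>) \<subseteq> verts (with_proj (overlap_graph k))"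
    using node by (auto simp: pattern_path_def overlap_graph_def simp del: upt_Suc)
  show "set (vwalk_arcs (pattern_path k \<pi>)) \<subseteq> arcs_ends (with_proj (overlap_graph k))"
  proof
    fix e assume "e \<in> set (vwalk_arcs (pattern_path k \<pi>))"
    then obtain i where i: "i < length \<pi> - k" "e = (pattern (?f i), pattern (?f (Suc i)))"
      by (force dest: vwalk_arcs_nth simp: pattern_path_def simp del: upt_Suc)
    have "tl (?f i) = butlast (?f (Suc i))"
      using i by (intro nth_equalityI) (auto simp: nth_tl nth_butlast)
    then have "pattern (tl (pattern (?f i))) = pattern (butlast (pattern (?f (Suc i))))"
      using pattern_cong[OF order_isomorphic_tl[OF pattern_order_isomorphic[OF df]], of i]
        pattern_cong[OF order_isomorphic_butlast[OF pattern_order_isomorphic[OF df]], of "Suc i"]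
      by simp
    then show "e \<in> arcs_ends (with_proj (overlap_graph k))"
      using i node by (auto simp: overlap_graph_def arcs_ends_def arc_to_ends_def)
  qed
  show "pattern_path k \<pi> \<noteq> []" by (simp add: pattern_path_def)
qed

end

theory Submission
  imports Defs
begin

text \<open>
  A permutation is uniquely \<open>k\<close>-determined if and only if any two neighbouring values stand at
  distance less than \<open>k\<close>: otherwise swapping them changes no window of length \<open>k\<close>, and
  conversely the path records the comparison of all positions at distance less than \<open>k\<close>, so the
  order of the values follows by transitivity.

  Let \<open>w\<close> be an irreducible prohibited pattern with end values \<open>x, x + 1\<close>, and let \<open>v\<close> be
  \<open>x + 2\<close> or \<open>x - 1\<close>, whichever occurs. Deleting either end of \<open>w\<close> makes \<open>v\<close> a neighbour of
  the other end, so \<open>v\<close> is at distance at most \<open>k - 1\<close> from both ends, and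
  \<open>length w \<le> 2 * k - 1\<close>. The bound is attained by
  \<open>1 (k+1) k \<dots> 3 (k+2) (k+3) \<dots> (2k-1) 2\<close>.
\<close>

section \<open>Unique determination in terms of neighbouring values\<close>

text \<open>Phrased with positions and the absence of an intermediate value rather than a difference
  of one. This keeps it invariant under order isomorphism and usable for words with gaps, such as a
  pattern with an end deleted.\<close>

definition neighbours :: "nat list \<Rightarrow> nat \<Rightarrow> nat \<Rightarrow> bool" where
  "neighbours u i j \<longleftrightarrow> i < length u \<and> j < length u \<and> u ! i < u ! j \<and>
     (\<forall>l<length u. \<not> (u ! i < u ! l \<and> u ! l < u ! j))"

definition neighbours_within :: "nat \<Rightarrow> nat list \<Rightarrow> bool" where
  "neighbours_within k u \<longleftrightarrow> (\<forall>i j. neighbours u i j \<longrightarrow> i < j + k \<and> j < i + k)"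

lemma order_isomorphic_neighbours:
  "order_isomorphic u v \<Longrightarrow> neighbours u i j \<longleftrightarrow> neighbours v i j"
  by (auto simp: order_isomorphic_def neighbours_def)

lemma neighbours_within_pattern:
  "distinct u \<Longrightarrow> neighbours_within k (pattern u) \<longleftrightarrow> neighbours_within k u"
  using order_isomorphic_neighbours[OF pattern_order_isomorphic]
  by (auto simp: neighbours_within_def)

lemma pattern_eq_iff:
  assumes "distinct u" "distinct v"
  shows "pattern u = pattern v \<longleftrightarrow> order_isomorphic u v"
  using pattern_order_isomorphic[OF assms(1)] pattern_order_isomorphic[OF assms(2)]
  by (metis order_isomorphic_sym order_isomorphic_trans pattern_cong)

text \<open>Two positions lie in a common window of length \<open>k\<close> exactly when their
  distance is less than \<open>k\<close>.\<close>

lemma pattern_path_eq_iff: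
  assumes u: "distinct u" and v: "distinct v" and len: "length u = length v"
    and k: "k \<le> length u"
  shows "pattern_path k u = pattern_path k v \<longleftrightarrow>
    (\<forall>a<length u. \<forall>b<length u. a < b + k \<longrightarrow> b < a + k \<longrightarrow> (u ! a < u ! b \<longleftrightarrow> v ! a < v ! b))"
    (is "?L \<longleftrightarrow> ?R")
proof -
  let ?n = "length u"
  have "?L \<longleftrightarrow> (\<forall>i<?n - k + 1. pattern (take k (drop i u)) = pattern (take k (drop i v)))"
    using len by (auto simp: pattern_path_def simp del: upt_Suc)
  also have "\<dots> \<longleftrightarrow> (\<forall>i<?n - k + 1. order_isomorphic (take k (drop i u)) (take k (drop i v)))"
    using u v by (simp add: pattern_eq_iff)
  also have "\<dots> \<longleftrightarrow> (\<forall>i\<le>?n - k. \<forall>a<k. \<forall>b<k. u ! (i + a) < u ! (i + b) \<longleftrightarrow> v ! (i + a) < v ! (i + b))"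
    using len k by (auto simp: order_isomorphic_def less_Suc_eq_le)
  also have "\<dots> \<longleftrightarrow> ?R"
  proof (rule iffI; intro allI impI)
    fix a b
    assume win: "\<forall>i\<le>?n - k. \<forall>a<k. \<forall>b<k.
        u ! (i + a) < u ! (i + b) \<longleftrightarrow> v ! (i + a) < v ! (i + b)"
      and ab: "a < ?n" "b < ?n" "a < b + k" "b < a + k"
    \<comment> \<open>The window starts at the smaller position, capped at \<open>?n - k\<close> so
      that it still fits into the word.\<close>
    define i where "i = min (min a b) (?n - k)"
    have "i \<le> ?n - k" "a - i < k" "b - i < k" "i + (a - i) = a" "i + (b - i) = b"
      using ab k by (auto simp: i_def)
    with win show "u ! a < u ! b \<longleftrightarrow> v ! a < v ! b" by metis
  next
    fix i a b
    assume "?R" "i \<le> ?n - k" "a < k" "b < k"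
    then show "u ! (i + a) < u ! (i + b) \<longleftrightarrow> v ! (i + a) < v ! (i + b)"
      using k by auto
  qed
  finally show ?thesis .
qed

text \<open>Since no value lies strictly between the two swapped ones, every third value compares
  alike with both.\<close>

lemma swap_neighbours_less_iff:
  assumes d: "distinct u" and nb: "neighbours u i j"
    and ab: "a < length u" "b < length u" "{a, b} \<noteq> {i, j}"
  defines "v \<equiv> u[i := u ! j, j := u ! i]"
  shows "v ! a < v ! b \<longleftrightarrow> u ! a < u ! b"
proof -
  have ij: "i < length u" "j < length u" "u ! i < u ! j"
    and no: "\<And>l. l < length u \<Longrightarrow> \<not> (u ! i < u ! l \<and> u ! l < u ! j)"
    using nb by (auto simp: neighbours_def)
  have outside: "(u ! l < u ! i \<longleftrightarrow> u ! l < u ! j) \<and> (u ! i < u ! l \<longleftrightarrow> u ! j < u ! l)"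
    if "l < length u" "l \<noteq> i" "l \<noteq> j" for l
  proof -
    have "u ! l \<noteq> u ! i" "u ! l \<noteq> u ! j"
      using d ij that by (auto simp: nth_eq_iff_index_eq)
    then show ?thesis using no[OF that(1)] ij(3) by linarith
  qed
  have nth: "v ! l = (if l = j then u ! i else if l = i then u ! j else u ! l)"
    if "l < length u" for l
    using that ij by (auto simp: v_def nth_list_update)
  show ?thesis
    using outside[OF ab(1)] outside[OF ab(2)] ab ij(3) by (auto simp: nth)
qed

lemma uniquely_determined_imp_neighbours_within:
  assumes ud: "uniquely_determined k p"
  shows "neighbours_within k p"
proof (rule ccontr)
  assume "\<not> neighbours_within k p"
  then obtain i j where nb: "neighbours p i j" and far: "\<not> (i < j + k \<and> j < i + k)"
    by (auto simp: neighbours_within_def)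
  let ?q = "p[i := p ! j, j := p ! i]"
  have p: "p \<in> permutations_of_set {1..length p}"
    using ud by (simp add: uniquely_determined_def)
  then have d: "distinct p" by (simp add: permutations_of_set_def)
  have ij: "i < length p" "j < length p" "p ! i < p ! j"
    using nb by (auto simp: neighbours_def)
  \<comment> \<open>Two positions at distance at least \<open>k\<close> force this, so the
    uniqueness clause of \<open>uniquely_determined\<close> applies.\<close>
  then have k: "k \<le> length p" using far by linarith
  have q: "?q \<in> permutations_of_set {1..length p}"
    using p ij by (simp add: permutations_of_set_def distinct_swap)
  have "pattern_path k p = pattern_path k ?q"
  proof (subst pattern_path_eq_iff)
    show "distinct ?q" using d ij by (simp add: distinct_swap)
    show "\<forall>a<length p. \<forall>b<length p. a < b + k \<longrightarrow> b < a + k \<longrightarrow> (p ! a < p ! b \<longleftrightarrow> ?q ! a < ?q ! b)"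
    proof (intro allI impI)
      fix a b
      assume ab: "a < length p" "b < length p" "a < b + k" "b < a + k"
      then have "{a, b} \<noteq> {i, j}" using far by (auto simp: doubleton_eq_iff)
      then show "p ! a < p ! b \<longleftrightarrow> ?q ! a < ?q ! b"
        using swap_neighbours_less_iff[OF d nb ab(1,2)] by simp
    qed
  qed (use d k in auto)
  then have "?q = p"
    using ud k q by (auto simp: uniquely_determined_def)
  then have "?q ! j = p ! j" by simp
  then show False using ij by simp
qed

lemma neighbours_within_imp_uniquely_determined:
  assumes p: "p \<in> permutations_of_set {1..length p}" and nw: "neighbours_within k p"
  shows "uniquely_determined k p"
  unfolding uniquely_determined_def
proof (intro conjI impI ballI)
  fix q
  assume k: "k \<le> length p" and q: "q \<in> permutations_of_set {1..length p}"
    and path: "pattern_path k q = pattern_path k p"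
  have dp: "distinct p" and dq: "distinct q" and len: "length q = length p"
    using p q permutations_of_set_nth_rank(1)[OF q] distinct_card[of q]
    by (auto simp: permutations_of_set_def)
  have near: "p ! a < p ! b \<longleftrightarrow> q ! a < q ! b"
    if "a < length p" "b < length p" "a < b + k" "b < a + k" for a b
    using that path pattern_path_eq_iff[OF dp dq len[symmetric] k] by simp
  \<comment> \<open>Induction on the gap between the values: neighbours share a window, where the
    paths agree; otherwise an intermediate value splits the gap into two smaller ones.\<close>
  have mono: "q ! a < q ! b" if "a < length p" "b < length p" "p ! a < p ! b" for a b
    using that
  proof (induction "p ! b - p ! a" arbitrary: a b rule: less_induct)
    case less
    show ?case
    proof (cases "neighbours p a b")
      case True
      then show ?thesis using near less.prems nw by (auto simp: neighbours_within_def)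
    next
      case False
      then obtain l where l: "l < length p" "p ! a < p ! l" "p ! l < p ! b"
        using less.prems by (auto simp: neighbours_def)
      have "q ! a < q ! l" "q ! l < q ! b"
        using less.prems l by (auto intro: less.hyps)
      then show ?thesis by simp
    qed
  qed
  have "order_isomorphic q p"
    unfolding order_isomorphic_def
  proof (intro conjI allI impI iffI)
    fix a b
    assume ab: "a < length q" "b < length q" "q ! a < q ! b"
    \<comment> \<open>By totality: the opposite order in \<open>p\<close> would carry over to
      \<open>q\<close>.\<close>
    then have "p ! a \<noteq> p ! b" using dp len by (auto simp: nth_eq_iff_index_eq)
    then show "p ! a < p ! b" using mono[of b a] ab len by fastforce
  qed (use len mono in auto)
  then show "q = p" using order_isomorphic_permutations_eq[OF q p] by blast
qed (rule p)

text \<open>Allows the factors of a word to be examined directly, without computing their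
  patterns.\<close>

lemma uniquely_determined_pattern_iff:
  assumes "distinct u"
  shows "uniquely_determined k (pattern u) \<longleftrightarrow> neighbours_within k u"
proof -
  have "pattern u \<in> permutations_of_set {1..length (pattern u)}"
    using pattern_in_permutations[OF assms] pattern_order_isomorphic[OF assms]
    by (simp add: order_isomorphic_def)
  then show ?thesis
    using uniquely_determined_imp_neighbours_within neighbours_within_imp_uniquely_determined
      neighbours_within_pattern[OF assms]
    by blast
qed

text \<open>A form symmetric in \<open>i\<close> and \<open>j\<close>, for use when it is open which
  of the two values is larger.\<close>

lemma neighbours_withinD:
  assumes nw: "neighbours_within k u" and ij: "i < length u" "j < length u" "u ! i \<noteq> u ! j"
    and no: "\<And>c. c \<in> set u \<Longrightarrow> \<not> (min (u ! i) (u ! j) < c \<and> c < max (u ! i) (u ! j))"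
  shows "i < j + k \<and> j < i + k"
proof (cases "u ! i < u ! j")
  case True
  then have "neighbours u i j"
    using ij no nth_mem by (fastforce simp: neighbours_def)
  then show ?thesis using nw by (simp add: neighbours_within_def)
next
  case False
  then have "neighbours u j i"
    using ij no nth_mem by (fastforce simp: neighbours_def)
  then show ?thesis using nw by (auto simp: neighbours_within_def)
qed

section \<open>Upper bound on the length\<close>

lemma prohibitedE:
  assumes "prohibited k w"
  obtains a X b where "w = a # X @ [b]" "distinct w" "set w = {1..length w}" "length X \<ge> k - 1"
    "b = Suc a \<or> a = Suc b"
proof -
  from assms obtain x X where x: "x \<ge> 1" "length X \<ge> k - 1"
    and X: "X \<in> permutations_of_set ({1..length X + 2} - {x, x + 1})"
    and w: "w = [x] @ X @ [x + 1] \<or> w = [x + 1] @ X @ [x]"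
    by (auto simp: prohibited_def)
  have dX: "distinct X" and sX: "set X = {1..length X + 2} - {x, x + 1}"
    using X by (auto simp: permutations_of_set_def)
  \<comment> \<open>Counting shows that both \<open>x\<close> and \<open>x + 1\<close> are really
    removed from the interval, hence lie in it.\<close>
  have "length X = card ({1..length X + 2} - {x, x + 1})"
    using dX sX distinct_card by metis
  also have "\<dots> = length X + 2 - card ({1..length X + 2} \<inter> {x, x + 1})"
    by (simp add: card_Diff_subset_Int)
  finally have c: "card ({1..length X + 2} \<inter> {x, x + 1}) \<ge> 2" by linarith
  have "x + 1 \<le> length X + 2"
  proof (rule ccontr)
    assume "\<not> x + 1 \<le> length X + 2"
    then have "{1..length X + 2} \<inter> {x, x + 1} \<subseteq> {x}" by auto
    then have "card ({1..length X + 2} \<inter> {x, x + 1}) \<le> card {x}" by (intro card_mono) auto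
    with c show False by simp
  qed
  then have sub: "{x, x + 1} \<subseteq> {1..length X + 2}" using x by auto
  have "x \<notin> set X" "x + 1 \<notin> set X" using sX by auto
  then have "distinct w" using w dX by (elim disjE) simp_all
  have "set w = insert x (insert (x + 1) (set X))" using w by (elim disjE) auto
  also have "\<dots> = {1..length X + 2}" unfolding sX using sub by blast
  also have "length X + 2 = length w" using w by (elim disjE) simp_all
  finally have "set w = {1..length w}" .
  note dw = \<open>distinct w\<close> this
  show thesis
    using w
  proof
    assume "w = [x] @ X @ [x + 1]"
    then show thesis using that[of x X "x + 1", OF _ dw x(2)] by simp
  next
    assume "w = [x + 1] @ X @ [x]"
    then show thesis using that[of "x + 1" X x, OF _ dw x(2)] by simp
  qed
qed

lemma irreducible_prohibited_length_le:
  assumes k: "k \<ge> 2" and "irreducible_prohibited k w"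
  shows "length w \<le> 2 * k - 1"
proof -
  have pr: "prohibited k w"
    and ud: "uniquely_determined k (pattern (tl w))" "uniquely_determined k (pattern (butlast w))"
    using assms(2) by (auto simp: irreducible_prohibited_def)
  from pr obtain a X b where w: "w = a # X @ [b]" and d: "distinct w"
    and s: "set w = {1..length w}" and len: "length X \<ge> k - 1"
    and ab: "b = Suc a \<or> a = Suc b"
    by (rule prohibitedE)
  have nw: "neighbours_within k (X @ [b])" "neighbours_within k (a # X)"
    using ud d uniquely_determined_pattern_iff[of "X @ [b]"]
      uniquely_determined_pattern_iff[of "a # X"]
    by (auto simp: w butlast_append)
  define v where "v = (if max a b < length w then max a b + 1 else min a b - 1)"
  have "a \<in> {1..length w}" "b \<in> {1..length w}" using s w by auto
  \<comment> \<open>Keeps \<open>v\<close> positive: if the larger end value is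
    \<open>length w\<close>, the smaller one is at least 2.\<close>
  moreover have "length w \<ge> 3" using len k w by simp
  ultimately have v: "v \<in> {1..length w}" "v = max a b + 1 \<or> v + 1 = min a b"
    using ab by (auto simp: v_def)
  then have "v \<in> set w" "v \<noteq> a" "v \<noteq> b" using s by auto
  then have "v \<in> set X" using w by auto
  then obtain l where l: "l < length X" "X ! l = v" by (auto simp: in_set_conv_nth)
  have out: "a \<notin> set (X @ [b])" "b \<notin> set (a # X)" using d w by auto
  \<comment> \<open>Only \<open>a\<close> could lie strictly between \<open>v\<close> and
    \<open>b\<close>, and it has been deleted here. Below, the roles of the ends are
    exchanged.\<close>
  have "l < length X + k \<and> length X < l + k"
  proof (rule neighbours_withinD[OF nw(1)])
    fix c assume "c \<in> set (X @ [b])"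
    then have "c \<noteq> a" using out by blast
    then show "\<not> (min ((X @ [b]) ! l) ((X @ [b]) ! length X) < c \<and>
        c < max ((X @ [b]) ! l) ((X @ [b]) ! length X))"
      using l v(2) ab by (auto simp: nth_append)
  qed (use l \<open>v \<noteq> b\<close> in \<open>auto simp: nth_append\<close>)
  moreover have "0 < Suc l + k \<and> Suc l < 0 + k"
  proof (rule neighbours_withinD[OF nw(2)])
    fix c assume "c \<in> set (a # X)"
    then have "c \<noteq> b" using out by blast
    then show "\<not> (min ((a # X) ! 0) ((a # X) ! Suc l) < c \<and>
        c < max ((a # X) ! 0) ((a # X) ! Suc l))"
      using l v(2) ab by auto
  qed (use l \<open>v \<noteq> a\<close> in auto)
  \<comment> \<open>From \<open>length X < l + k\<close> and \<open>Suc l < k\<close> follows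
    \<open>length X \<le> 2 * k - 3\<close>; the two ends add 2.\<close>
  ultimately show ?thesis using w by simp
qed

section \<open>A pattern attaining the bound\<close>

text \<open>The descending block ends with 3 in the exact centre, so that in the full word 3 is at
  distance \<open>k - 1\<close> from both ends.\<close>

definition extremal_middle :: "nat \<Rightarrow> nat list" where
  "extremal_middle k = rev [3..<k + 2] @ [k + 2..<2 * k]"

lemma extremal_middle:
  assumes "k \<ge> 2"
  shows "length (extremal_middle k) = 2 * k - 3" "distinct (extremal_middle k)"
    "set (extremal_middle k) = {3..<2 * k}"
    "i < 2 * k - 3 \<Longrightarrow> extremal_middle k ! i = (if i < k - 1 then k + 1 - i else i + 3)"
  using assms by (auto simp: extremal_middle_def nth_append rev_nth simp del: upt_Suc)

lemma neighbours_nth_le: "neighbours u i j \<Longrightarrow> c \<in> set u \<Longrightarrow> u ! i < c \<Longrightarrow> u ! j \<le> c"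
  by (force simp: neighbours_def in_set_conv_nth)

text \<open>Consecutive values within a block are adjacent. The only passage between the blocks,
  from \<open>k + 1\<close> to \<open>k + 2\<close>, goes from position 0 to position
  \<open>k - 1\<close>.\<close>

lemma extremal_middle_near:
  assumes k: "k \<ge> 2" and ij: "i < 2 * k - 3" "j < 2 * k - 3"
    and suc: "extremal_middle k ! j = Suc (extremal_middle k ! i)"
  shows "i < j + k \<and> j < i + k"
  using suc ij by (auto simp: extremal_middle(4)[OF k] split: if_splits)

lemma neighbours_within_extremal:
  assumes k: "k \<ge> 2"
  shows "neighbours_within k (1 # extremal_middle k)"
    and "neighbours_within k (extremal_middle k @ [2])"
proof -
  let ?M = "extremal_middle k"
  note M = extremal_middle[OF k]
  have nth3: "j = k - 2" if "j < 2 * k - 3" "?M ! j \<le> 3" for j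
    using that k by (auto simp: M(4) split: if_splits)
  have le: "3 \<le> ?M ! j" "?M ! j < 2 * k" if "j < 2 * k - 3" for j
    using that M(1,3) nth_mem[of j ?M] by auto
  show "neighbours_within k (1 # ?M)"
    unfolding neighbours_within_def
  proof (intro allI impI)
    fix i j
    assume nb: "neighbours (1 # ?M) i j"
    then have ij: "i < 2 * k - 2" "j < 2 * k - 2" "(1 # ?M) ! i < (1 # ?M) ! j"
      using k by (auto simp: neighbours_def M(1))
    \<comment> \<open>The entry 1 at position 0 is the least value, so it is never the upper
      neighbour.\<close>
    have "j \<noteq> 0"
    proof
      assume "j = 0"
      with ij have "?M ! (i - 1) < 1" "i - 1 < 2 * k - 3"
        by (auto simp: nth_Cons split: nat.splits)
      then show False using le(1)[of "i - 1"] by linarith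
    qed
    then obtain j' where j: "j = Suc j'" "j' < 2 * k - 3"
      using ij by (cases j) auto
    show "i < j + k \<and> j < i + k"
    \<comment> \<open>The upper neighbour of 1 is 3, because 2 is absent; any other pair lies in the
      middle word, whose values form an interval, and is therefore consecutive.\<close>
    proof (cases i)
      case 0
      then have "?M ! j' \<le> 3"
        using neighbours_nth_le[OF nb, of 3] j k by (simp add: M(3))
      then show ?thesis using nth3[OF j(2)] j 0 k by simp
    next
      case (Suc i')
      then have i: "i' < 2 * k - 3" "?M ! i' < ?M ! j'" using ij j by auto
      then have "Suc (?M ! i') \<in> set ?M" using le[OF i(1)] le[OF j(2)] by (simp add: M(3))
      then have "?M ! j' \<le> Suc (?M ! i')"
        using neighbours_nth_le[OF nb, of "Suc (?M ! i')"] j Suc by simp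
      then show ?thesis using extremal_middle_near[OF k i(1) j(2)] i j Suc by simp
    qed
  qed
  show "neighbours_within k (?M @ [2])"
    unfolding neighbours_within_def
  proof (intro allI impI)
    fix i j
    assume nb: "neighbours (?M @ [2]) i j"
    then have ij: "i < 2 * k - 2" "j < 2 * k - 2" "(?M @ [2]) ! i < (?M @ [2]) ! j"
      using k by (auto simp: neighbours_def M(1))
    \<comment> \<open>Here the least value is the final 2, and 3 is again its upper
      neighbour.\<close>
    have j: "j < 2 * k - 3"
    proof (rule ccontr)
      assume "\<not> j < 2 * k - 3"
      then have "j = 2 * k - 3" using ij by linarith
      then have "i < 2 * k - 3 \<and> ?M ! i < 2" using ij by (auto simp: nth_append M(1) split: if_splits)
      then show False using le by fastforce
    qed
    show "i < j + k \<and> j < i + k"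
    proof (cases "i < 2 * k - 3")
      case False
      then have i: "i = 2 * k - 3" using ij by linarith
      then have "?M ! j \<le> 3"
        using neighbours_nth_le[OF nb, of 3] j k by (simp add: M(1,3) nth_append)
      then show ?thesis using nth3[OF j] i k by linarith
    next
      case True
      then have i: "?M ! i < ?M ! j" using ij j by (auto simp: M(1) nth_append)
      then have "Suc (?M ! i) \<in> set ?M" using le[OF True] le[OF j] by (simp add: M(3))
      then have "?M ! j \<le> Suc (?M ! i)"
        using neighbours_nth_le[OF nb, of "Suc (?M ! i)"] j True by (simp add: M(1) nth_append)
      then show ?thesis using extremal_middle_near[OF k True j] i by simp
    qed
  qed
qed

lemma irreducible_prohibited_extremal:
  assumes k: "k \<ge> 2"
  shows "irreducible_prohibited k (1 # extremal_middle k @ [2])"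
proof -
  note M = extremal_middle[OF k]
  have "{1..length (extremal_middle k) + 2} - {1, 1 + 1} = {3..<2 * k}"
    using k by (auto simp: M(1))
  then have "prohibited k (1 # extremal_middle k @ [2])"
    using k M unfolding prohibited_def
    by (intro exI[of _ 1] exI[of _ "extremal_middle k"]) (simp add: permutations_of_set_def)
  moreover have "uniquely_determined k (pattern (extremal_middle k @ [2]))"
    "uniquely_determined k (pattern (1 # extremal_middle k))"
    using neighbours_within_extremal[OF k] M(2,3) by (simp_all add: uniquely_determined_pattern_iff)
  ultimately show ?thesis by (simp add: irreducible_prohibited_def butlast_append)
qed

theorem theorem5:
  fixes k :: nat
  assumes "k \<ge> 2"
  shows "finite (irreducible_prohibited_patterns k) \<and>
    (\<exists>w\<in>irreducible_prohibited_patterns k. length w = 2 * k - 1) \<and>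
    (\<forall>w\<in>irreducible_prohibited_patterns k. length w \<le> 2 * k - 1)"
proof (intro conjI)
  show le: "\<forall>w\<in>irreducible_prohibited_patterns k. length w \<le> 2 * k - 1"
    using irreducible_prohibited_length_le[OF assms]
    by (simp add: irreducible_prohibited_patterns_def)
  have "set w = {1..length w}" if "w \<in> irreducible_prohibited_patterns k" for w
    using that prohibitedE
    by (metis irreducible_prohibited_def irreducible_prohibited_patterns_def mem_Collect_eq)
  \<comment> \<open>Letters are bounded by the length, so the length bound leaves only words of
    bounded length over a finite alphabet.\<close>
  then have "irreducible_prohibited_patterns k \<subseteq>
      {w. set w \<subseteq> {1..2 * k - 1} \<and> length w \<le> 2 * k - 1}"
    using le by fastforce
  then show "finite (irreducible_prohibited_patterns k)"
    by (rule finite_subset) (simp add: finite_lists_length_le)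
  show "\<exists>w\<in>irreducible_prohibited_patterns k. length w = 2 * k - 1"
    using irreducible_prohibited_extremal[OF assms] extremal_middle(1)[OF assms] assms
    by (intro bexI[of _ "1 # extremal_middle k @ [2]"])
      (auto simp: irreducible_prohibited_patterns_def)
qed

end
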